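(* Let $G$ be a finite group and let $u\in V(\mathbb{Z}G)$ be a torsion unit of the integral group ring $\mathbb{Z}G$, of order $|u|$. Let $k, n$ be positive integers such that $k$ is coprime to the exponent of $G$. If $n$ and $k$ are both congruent to $1$ modulo $|u|$, then for every $s\in G$ we have $$\nu_{s}(u) = \sum_{(r,t):\ r \mid t \mid n} \mu(r) \cdot \Big( \sum_{x^{G}\in C_{r,t}(s)} \nu_{x}(u)\Big),$$ where the outer sum runs over all pairs $(r,t)$ of positive integers with $r\mid t$ and $t\mid n$, and, for each such pair, $C_{r,t}(s)$ denotes the set of conjugacy classes $x^{G}$ of $G$ for which $x^{k}$ is conjugate to $s$ in $G$ and there exists $y\in G$ with $y^{knr/t}=x^{k}$.
   Context: For a group $G$, $V(\mathbb{Z}G)$ denotes the group of normalized units of the integral group ring $\mathbb{Z}G$, i.e. the units $\sum_{g\in G}\alpha_g g$ with $\alpha_g\in\mathbb{Z}$ and $\sum_{g\in G}\alpha_g=1$. A torsion unit is a unit $u$ of finite multiplicative order, denoted $|u|$. For $g\in G$, $g^G$ denotes the conjugacy class of $g$ in $G$. For $w=\sum_{g\in G}\alpha_g g\in\mathbb{Z}G$ and $y\in G$, the partial augmentation of $w$ with respect to $y$ is $\nu_y(w)=\sum_{g\in y^G}\alpha_g$; it depends only on the conjugacy class of $y$. $\mu$ is the Möbius function on positive integers: $\mu(1)=1$, $\mu(n)=0$ if $n$ is divisible by the square of a prime, and $\mu(n)=(-1)^{\ell}$ if $n$ is a product of $\ell$ distinct primes. The condition defining $C_{r,t}(s)$ does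 not depend on the representative $x$ of the class $x^G$; each class is counted once in the inner sum. *)

theory Defs
  imports
    "HOL-Algebra.Group_Action"
    "HOL-Algebra.Multiplicative_Group"
    "HOL-Computational_Algebra.Squarefree"
    "HOL-Number_Theory.Cong"
begin

text \<open>
  The element \<open>\<Sum>g\<in>G. \<alpha>\<^sub>g g\<close> is represented by its coefficient function
  \<open>\<alpha> :: 'a \<Rightarrow> int\<close>, required to be \<open>0\<close> outside the carrier so that equality in the
  ring is equality of functions.  No finite-support condition is imposed, so this is the group
  ring only for a finite group \<open>G\<close>.
\<close>

definition int_group_ring :: "('a, 'b) monoid_scheme \<Rightarrow> ('a \<Rightarrow> int) ring" where
  "int_group_ring G =
     \<lparr>carrier = {w. \<forall>x. x \<notin> carrier G \<longrightarrow> w x = 0},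
      monoid.mult = (\<lambda>v w x. \<Sum>(y, z) | y \<in> carrier G \<and> z \<in> carrier G \<and> y \<otimes>\<^bsub>G\<^esub> z = x. v y * w z),
      one = (\<lambda>x. if x = \<one>\<^bsub>G\<^esub> then 1 else 0),
      zero = (\<lambda>x. 0),
      add = (\<lambda>v w x. v x + w x)\<rparr>"

definition augmentation :: "('a, 'b) monoid_scheme \<Rightarrow> ('a \<Rightarrow> int) \<Rightarrow> int" where
  "augmentation G w = (\<Sum>g\<in>carrier G. w g)"

definition normalized_units :: "('a, 'b) monoid_scheme \<Rightarrow> ('a \<Rightarrow> int) set" where
  "normalized_units G = {u \<in> Units (int_group_ring G). augmentation G u = 1}"

definition torsion_unit :: "('a, 'b) monoid_scheme \<Rightarrow> ('a \<Rightarrow> int) \<Rightarrow> bool" where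
  "torsion_unit G u \<longleftrightarrow> u \<in> Units (int_group_ring G) \<and>
     (\<exists>m::nat. m > 0 \<and> u [^]\<^bsub>int_group_ring G\<^esub> m = \<one>\<^bsub>int_group_ring G\<^esub>)"

definition unit_order :: "('a, 'b) monoid_scheme \<Rightarrow> ('a \<Rightarrow> int) \<Rightarrow> nat" where
  "unit_order G u = group.ord (units_of (int_group_ring G)) u"

definition conj_class :: "('a, 'b) monoid_scheme \<Rightarrow> 'a \<Rightarrow> 'a set" where
  "conj_class G x =
     orbit G (\<lambda>g. \<lambda>h\<in>carrier G. g \<otimes>\<^bsub>G\<^esub> h \<otimes>\<^bsub>G\<^esub> inv\<^bsub>G\<^esub> g) x"

text \<open>
  A partial augmentation depends only on the conjugacy class, so it is given both as a function
  of the class \<open>C\<close> and as a function of an element \<open>y\<close>.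
\<close>

definition class_partial_augmentation :: "'a set \<Rightarrow> ('a \<Rightarrow> int) \<Rightarrow> int" where
  "class_partial_augmentation C w = (\<Sum>g\<in>C. w g)"

definition partial_augmentation ::
    "('a, 'b) monoid_scheme \<Rightarrow> 'a \<Rightarrow> ('a \<Rightarrow> int) \<Rightarrow> int" where
  "partial_augmentation G y w = class_partial_augmentation (conj_class G y) w"

definition group_exponent :: "('a, 'b) monoid_scheme \<Rightarrow> nat" where
  "group_exponent G = (LEAST e. e > 0 \<and> (\<forall>x\<in>carrier G. x [^]\<^bsub>G\<^esub> e = \<one>\<^bsub>G\<^esub>))"

definition moebius :: "nat \<Rightarrow> int" where
  "moebius n = (if squarefree n then (- 1) ^ card (prime_factors n) else 0)"

text \<open>
  A set of classes, so each class is counted once.  For \<open>t\<close> dividing \<open>n\<close> the exponent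
  \<open>k * n * r div t\<close> is the exact quotient \<open>knr/t\<close>.
\<close>

definition root_classes ::
    "('a, 'b) monoid_scheme \<Rightarrow> nat \<Rightarrow> nat \<Rightarrow> nat \<Rightarrow> nat \<Rightarrow> 'a \<Rightarrow> 'a set set" where
  "root_classes G k n r t s =
     {conj_class G x | x. x \<in> carrier G \<and> x [^]\<^bsub>G\<^esub> k \<in> conj_class G s \<and>
        (\<exists>y\<in>carrier G. y [^]\<^bsub>G\<^esub> (k * n * r div t) = x [^]\<^bsub>G\<^esub> k)}"

lemma conj_class_eq:
  assumes "x \<in> carrier G"
  shows "conj_class G x = {g \<otimes>\<^bsub>G\<^esub> x \<otimes>\<^bsub>G\<^esub> inv\<^bsub>G\<^esub> g | g. g \<in> carrier G}"
  using assms by (simp add: conj_class_def orbit_def)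

lemma (in group) int_group_ring_mult:
  assumes "x \<in> carrier G"
  shows "(v \<otimes>\<^bsub>int_group_ring G\<^esub> w) x = (\<Sum>y\<in>carrier G. v y * w (inv y \<otimes> x))"
  unfolding int_group_ring_def monoid.simps
  by (rule sum.reindex_bij_witness[where i = "\<lambda>y. (y, inv y \<otimes> x)" and j = fst])
     (use assms in \<open>auto simp: m_assoc[symmetric]\<close>)

lemma (in group) int_group_ring_mult_outside:
  assumes "x \<notin> carrier G"
  shows "(v \<otimes>\<^bsub>int_group_ring G\<^esub> w) x = 0"
proof -
  have "{(y, z). y \<in> carrier G \<and> z \<in> carrier G \<and> y \<otimes> z = x} = {}"
    using assms by auto
  then show ?thesis
    by (simp only: int_group_ring_def monoid.simps sum.empty)
qed

lemma (in group) int_group_ring_assoc: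
  assumes "finite (carrier G)"
  shows "(f \<otimes>\<^bsub>int_group_ring G\<^esub> g) \<otimes>\<^bsub>int_group_ring G\<^esub> h =
         f \<otimes>\<^bsub>int_group_ring G\<^esub> (g \<otimes>\<^bsub>int_group_ring G\<^esub> h)" (is "?l = ?r")
proof
  fix x
  show "?l x = ?r x"
  proof (cases "x \<in> carrier G")
    case True
    have "?l x = (\<Sum>w\<in>carrier G. \<Sum>y\<in>carrier G. f y * g (inv y \<otimes> w) * h (inv w \<otimes> x))"
      using True by (simp add: int_group_ring_mult sum_distrib_right cong: sum.cong)
    also have "\<dots> = (\<Sum>y\<in>carrier G. \<Sum>w\<in>carrier G. f y * g (inv y \<otimes> w) * h (inv w \<otimes> x))"
      by (rule sum.swap)
    also have "\<dots> = (\<Sum>y\<in>carrier G. \<Sum>v\<in>carrier G. f y * (g v * h (inv v \<otimes> (inv y \<otimes> x))))"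
    proof (rule sum.cong[OF refl])
      fix y assume y: "y \<in> carrier G"
      have c1: "y \<otimes> (inv y \<otimes> z) = z" if "z \<in> carrier G" for z
        using that y by (simp add: m_assoc[symmetric])
      have c2: "inv y \<otimes> (y \<otimes> z) = z" if "z \<in> carrier G" for z
        using that y by (simp add: m_assoc[symmetric])
      show "(\<Sum>w\<in>carrier G. f y * g (inv y \<otimes> w) * h (inv w \<otimes> x)) =
            (\<Sum>v\<in>carrier G. f y * (g v * h (inv v \<otimes> (inv y \<otimes> x))))"
        by (rule sum.reindex_bij_witness[where i = "\<lambda>v. y \<otimes> v" and j = "\<lambda>w. inv y \<otimes> w"])
           (use y True in \<open>auto simp: m_assoc inv_mult_group c1 c2\<close>)
    qed
    also have "\<dots> = ?r x"
      using True by (simp add: int_group_ring_mult sum_distrib_left cong: sum.cong)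
    finally show ?thesis .
  qed (simp add: int_group_ring_mult_outside)
qed

lemma (in group) int_group_ring_is_ring:
  assumes fin: "finite (carrier G)"
  shows "ring (int_group_ring G)"
proof (rule ringI)
  let ?R = "int_group_ring G"
  have carr: "w \<in> carrier ?R \<longleftrightarrow> (\<forall>x. x \<notin> carrier G \<longrightarrow> w x = 0)" for w
    by (simp add: int_group_ring_def)
  have add: "v \<oplus>\<^bsub>?R\<^esub> w = (\<lambda>x. v x + w x)" for v w
    by (simp add: int_group_ring_def)
  have one: "\<one>\<^bsub>?R\<^esub> = (\<lambda>x. if x = \<one> then 1 else 0)"
    by (simp add: int_group_ring_def)
  have zero: "\<zero>\<^bsub>?R\<^esub> = (\<lambda>x. 0)"
    by (simp add: int_group_ring_def)
  show "abelian_group ?R"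
  proof (rule abelian_groupI)
    fix w assume "w \<in> carrier ?R"
    then show "\<exists>v\<in>carrier ?R. v \<oplus>\<^bsub>?R\<^esub> w = \<zero>\<^bsub>?R\<^esub>"
      by (intro bexI[of _ "\<lambda>x. - w x"]) (auto simp: carr add zero)
  qed (auto simp: carr add zero)
  show "monoid ?R"
  proof (rule monoidI)
    fix w assume w: "w \<in> carrier ?R"
    show "\<one>\<^bsub>?R\<^esub> \<otimes>\<^bsub>?R\<^esub> w = w"
    proof
      fix x
      show "(\<one>\<^bsub>?R\<^esub> \<otimes>\<^bsub>?R\<^esub> w) x = w x"
      proof (cases "x \<in> carrier G")
        case True
        have "(\<one>\<^bsub>?R\<^esub> \<otimes>\<^bsub>?R\<^esub> w) x =
              (\<Sum>y\<in>carrier G. if y = \<one> then w (inv y \<otimes> x) else 0)"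
          unfolding int_group_ring_mult[OF True] one by (rule sum.cong) auto
        with True fin show ?thesis by (simp add: sum.delta)
      qed (use w in \<open>simp add: int_group_ring_mult_outside carr\<close>)
    qed
    show "w \<otimes>\<^bsub>?R\<^esub> \<one>\<^bsub>?R\<^esub> = w"
    proof
      fix x
      show "(w \<otimes>\<^bsub>?R\<^esub> \<one>\<^bsub>?R\<^esub>) x = w x"
      proof (cases "x \<in> carrier G")
        case True
        have "inv y \<otimes> x = \<one> \<longleftrightarrow> y = x" if "y \<in> carrier G" for y
          using that True inv_equality[of "inv y" x] by (auto simp: inv_solve_left')
        then have "(w \<otimes>\<^bsub>?R\<^esub> \<one>\<^bsub>?R\<^esub>) x = (\<Sum>y\<in>carrier G. if y = x then w y else 0)"
          unfolding int_group_ring_mult[OF True] one by (intro sum.cong) auto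
        with True fin show ?thesis by (simp add: sum.delta)
      qed (use w in \<open>simp add: int_group_ring_mult_outside carr\<close>)
    qed
  qed (auto simp: carr int_group_ring_mult_outside int_group_ring_assoc[OF fin], auto simp: one)
next
  let ?R = "int_group_ring G"
  fix f g h
  have add: "v \<oplus>\<^bsub>?R\<^esub> w = (\<lambda>x. v x + w x)" for v w
    by (simp add: int_group_ring_def)
  show "(f \<oplus>\<^bsub>?R\<^esub> g) \<otimes>\<^bsub>?R\<^esub> h = f \<otimes>\<^bsub>?R\<^esub> h \<oplus>\<^bsub>?R\<^esub> g \<otimes>\<^bsub>?R\<^esub> h"
  proof
    fix x
    show "((f \<oplus>\<^bsub>?R\<^esub> g) \<otimes>\<^bsub>?R\<^esub> h) x = (f \<otimes>\<^bsub>?R\<^esub> h \<oplus>\<^bsub>?R\<^esub> g \<otimes>\<^bsub>?R\<^esub> h) x"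
      by (cases "x \<in> carrier G")
         (simp_all add: add int_group_ring_mult int_group_ring_mult_outside
            distrib_right sum.distrib)
  qed
  show "h \<otimes>\<^bsub>?R\<^esub> (f \<oplus>\<^bsub>?R\<^esub> g) = h \<otimes>\<^bsub>?R\<^esub> f \<oplus>\<^bsub>?R\<^esub> h \<otimes>\<^bsub>?R\<^esub> g"
  proof
    fix x
    show "(h \<otimes>\<^bsub>?R\<^esub> (f \<oplus>\<^bsub>?R\<^esub> g)) x = (h \<otimes>\<^bsub>?R\<^esub> f \<oplus>\<^bsub>?R\<^esub> h \<otimes>\<^bsub>?R\<^esub> g) x"
      by (cases "x \<in> carrier G")
         (simp_all add: add int_group_ring_mult int_group_ring_mult_outside
            distrib_left sum.distrib)
  qed
qed

end

theory Submission
  imports Defs "HOL-Number_Theory.Residues"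
begin

text \<open>
  Since \<open>k\<close> is coprime to the exponent, the classes with \<open>x\<^sup>k\<close> conjugate to \<open>s\<close> reduce to a single
  one, \<open>x\<^sup>G\<close> with \<open>x\<^sup>k = s\<close>, so the inner sum depends only on \<open>d = nr/t\<close>.  Summing \<open>\<mu>(r)\<close> over
  \<open>r | d\<close> leaves only \<open>d = 1\<close>, and the double sum collapses to \<open>\<nu>\<^sub>x(u)\<close>.  It remains to see that
  \<open>\<nu>\<^sub>s(u) = \<nu>\<^sub>x(u)\<close>.

  Expanding \<open>w\<^sup>p\<close> over words of prime length \<open>p\<close> and rotating the words cyclically gives
  \<open>\<nu>\<^sub>y(w\<^sup>p) \<equiv> \<nu>\<^sub>x(w)\<close> modulo \<open>p\<close>, where \<open>y = x\<^sup>p\<close>, for \<open>p\<close> not dividing the exponent.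
  The powers of \<open>u\<close> have only finitely many partial augmentations, so for large \<open>p\<close> this is an
  equality.  By the Chinese remainder theorem \<open>k\<close> may be replaced by a number \<open>K\<close> congruent to it
  modulo the exponent and modulo \<open>|u|\<close>, all of whose prime factors are large; this avoids
  Dirichlet's theorem on primes in arithmetic progressions.
\<close>

subsection \<open>Number-theoretic preliminaries\<close>

lemma moebius_mult_prime:
  assumes "prime p" "\<not> p dvd r" "r > 0"
  shows "moebius (p * r) = - moebius r"
proof -
  have cop: "coprime p r"
    using assms by (simp add: prime_imp_coprime)
  have pf: "prime_factors (p * r) = insert p (prime_factors r)"
    using assms by (subst prime_factors_product) (auto simp: prime_prime_factors)
  have "squarefree (p * r) \<longleftrightarrow> squarefree r"
    using cop assms squarefree_mult_coprime[of p r] squarefree_multD[of p r]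
    by (auto simp: squarefree_prime)
  moreover have "p \<notin> prime_factors r"
    using assms by auto
  ultimately show ?thesis
    by (simp add: moebius_def pf)
qed

text \<open>Fix a prime \<open>p\<close> dividing \<open>d\<close>. The squarefree divisors not
  divisible by \<open>p\<close> pair off with their multiples by \<open>p\<close>, and the values of
  \<open>moebius\<close> in each pair cancel.\<close>

lemma sum_moebius_divisors:
  assumes "d > 0"
  shows "(\<Sum>r | r dvd d. moebius r) = (if d = 1 then 1 else 0)"
proof (cases "d = 1")
  case True
  then show ?thesis by (simp add: moebius_def)
next
  case False
  then obtain p where p: "prime p" "p dvd d"
    using prime_factor_nat by blast
  define A where "A = {r. r dvd d \<and> squarefree r \<and> \<not> p dvd r}"
  have fin: "finite {r. r dvd d}" using assms by simp
  then have finA: "finite A" by (auto simp: A_def intro: finite_subset)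
  have pos: "r > 0" if "r \<in> A" for r
    using that assms by (auto simp: A_def intro: Nat.gr0I)
  have image: "{r. r dvd d \<and> squarefree r \<and> p dvd r} = (*) p ` A"
  proof (intro equalityI subsetI)
    fix r assume "r \<in> {r. r dvd d \<and> squarefree r \<and> p dvd r}"
    then obtain q where q: "r = p * q" "p * q dvd d" "squarefree (p * q)" by auto
    have "\<not> p dvd q"
      using squarefreeD[OF q(3), of p] p by (auto simp: power2_eq_square)
    then show "r \<in> (*) p ` A"
      using q by (auto simp: A_def dest: dvd_mult_right squarefree_multD)
  next
    fix r assume "r \<in> (*) p ` A"
    then obtain q where q: "r = p * q" "q \<in> A" by auto
    then have cop: "coprime p q" using p by (simp add: A_def prime_imp_coprime)
    then show "r \<in> {r. r dvd d \<and> squarefree r \<and> p dvd r}"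
      using q p by (auto simp: A_def divides_mult squarefree_mult_coprime squarefree_prime)
  qed
  have "(\<Sum>r | r dvd d. moebius r) = (\<Sum>r | r dvd d \<and> squarefree r. moebius r)"
    using fin by (intro sum.mono_neutral_right) (auto simp: moebius_def)
  also have "{r. r dvd d \<and> squarefree r} = A \<union> (*) p ` A"
    unfolding image[symmetric] by (auto simp: A_def)
  also have "(\<Sum>r\<in>A \<union> (*) p ` A. moebius r) = (\<Sum>r\<in>A. moebius r) + (\<Sum>r\<in>(*) p ` A. moebius r)"
    using finA by (intro sum.union_disjoint) (auto simp: A_def)
  also have "(\<Sum>r\<in>(*) p ` A. moebius r) = (\<Sum>r\<in>A. moebius (p * r))"
    using p by (subst sum.reindex) (auto simp: inj_on_def prime_gt_0_nat)
  also have "\<dots> = (\<Sum>r\<in>A. - moebius r)"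
    using p(1) pos by (intro sum.cong moebius_mult_prime) (auto simp: A_def)
  finally show ?thesis using False by (simp add: sum_negf)
qed

text \<open>Regroup by \<open>d = n * r div t\<close>: the pairs \<open>(r, t)\<close> correspond to
  the pairs \<open>(d, r)\<close> with \<open>r dvd d\<close> and \<open>d dvd n\<close>. Summing
  over \<open>r\<close> first kills every \<open>d\<close> except 1.\<close>

lemma moebius_divisor_pairs_sum:
  fixes f :: "nat \<Rightarrow> int"
  assumes "n > 0"
  shows "(\<Sum>(r, t) | 0 < r \<and> 0 < t \<and> r dvd t \<and> t dvd n. moebius r * f (n * r div t)) = f 1"
proof -
  have "(\<Sum>(r, t) | 0 < r \<and> 0 < t \<and> r dvd t \<and> t dvd n. moebius r * f (n * r div t)) =
        (\<Sum>(d, r)\<in>Sigma {d. d dvd n} (\<lambda>d. {r. r dvd d}). moebius r * f d)"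
  proof (rule sum.reindex_bij_witness[where i = "\<lambda>(d, r). (r, n * r div d)"
        and j = "\<lambda>(r, t). (n * r div t, r)"], goal_cases)
    case (1 a)
    obtain r t where a: "a = (r, t)" "0 < r" "0 < t" "r dvd t" "t dvd n" using 1 by auto
    \<comment> \<open>In these coordinates \<open>n * r div t\<close> is exactly
      \<open>r * c\<close>, so every division in the bijection is exact.\<close>
    then obtain q c where "t = r * q" "n = r * q * c" by (auto elim!: dvdE)
    then show ?case using a assms by auto
  next
    case (2 a)
    then obtain r t where a: "a = (r, t)" "0 < r" "0 < t" "r dvd t" "t dvd n" by auto
    then obtain q c where "t = r * q" "n = r * q * c" by (auto elim!: dvdE)
    then have "n * r div t = r * c" "r * c dvd n" using a by auto
    then show ?case using a by auto
  next
    case (3 b)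
    then obtain d r where b: "b = (d, r)" "d dvd n" "r dvd d" by auto
    then obtain q c where "d = r * q" "n = r * q * c" by (auto elim!: dvdE)
    then show ?case using b assms by auto
  next
    case (4 b)
    then obtain d r where b: "b = (d, r)" "d dvd n" "r dvd d" by auto
    then obtain q c where "d = r * q" "n = r * q * c" by (auto elim!: dvdE)
    moreover from this have "n * r div d = r * c" using assms by simp
    ultimately show ?case using b assms by auto
  next
    case (5 a)
    then show ?case by auto
  qed
  also have "\<dots> = (\<Sum>d | d dvd n. (\<Sum>r | r dvd d. moebius r) * f d)"
    using assms by (subst sum.Sigma[symmetric]) 
      (auto simp: sum_distrib_right intro!: finite_divisors_nat Nat.gr0I)
  also have "\<dots> = (\<Sum>d | d dvd n. if d = 1 then f d else 0)"
    using assms by (intro sum.cong refl, subst sum_moebius_divisors) (auto intro: Nat.gr0I)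
  also have "\<dots> = f 1"
    using assms by simp
  finally show ?thesis .
qed

section \<open>Fixed points of maps of prime order, and congruences modulo a prime\<close>

lemma funpow_coprime_fixed:
  assumes "(\<sigma> ^^ a) x = x" "(\<sigma> ^^ p) x = x" "coprime a p" "p > 1"
  shows "\<sigma> x = x"
proof -
  have mult: "(\<sigma> ^^ (c * b)) x = x" if "(\<sigma> ^^ c) x = x" for b c
    using that by (induction b) (simp_all add: funpow_add)
  \<comment> \<open>Since \<open>a * b\<close> is 1 modulo \<open>p\<close>, iterating
    \<open>a * b\<close> times acts on \<open>x\<close> like a single \<sigma>; it also fixes
    \<open>x\<close>, because iterating \<open>a\<close> times does.\<close>
  obtain b where "[a * b = 1] (mod p)"
    using cong_solve_coprime_nat[OF assms(3)] by auto
  then have "a * b = Suc (p * (a * b div p))"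
    using assms(4) by (metis Suc_eq_plus1 cong_def div_mult_mod_eq mod_less mult.commute)
  then have "(\<sigma> ^^ (a * b)) x = \<sigma> ((\<sigma> ^^ (p * (a * b div p))) x)"
    by (metis comp_apply funpow.simps(2))
  then show ?thesis
    using mult[OF assms(1)] mult[OF assms(2)] by simp
qed

text \<open>As \<open>p\<close> is prime, every orbit of \<sigma> on \<open>X\<close> has 1 or
  \<open>p\<close> elements. Since \<open>f\<close> is constant on orbits, those with
  \<open>p\<close> elements contribute multiples of \<open>p\<close>; the induction removes one of
  them at a time.\<close>

lemma sum_fixed_points_cong:
  fixes f :: "'c \<Rightarrow> int"
  assumes "finite X" "prime p"
    and "\<And>x. x \<in> X \<Longrightarrow> \<sigma> x \<in> X" "\<And>x. x \<in> X \<Longrightarrow> (\<sigma> ^^ p) x = x"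
    and "\<And>x. x \<in> X \<Longrightarrow> f (\<sigma> x) = f x"
  shows "[sum f X = (\<Sum>x | x \<in> X \<and> \<sigma> x = x. f x)] (mod int p)"
  using assms(1,3-)
proof (induction X rule: finite_psubset_induct)
  case (psubset X)
  show ?case
  proof (cases "\<exists>x\<in>X. \<sigma> x \<noteq> x")
    case False
    then have "{x \<in> X. \<sigma> x = x} = X" by auto
    then show ?thesis by simp
  next
    case True
    then obtain x where x: "x \<in> X" "\<sigma> x \<noteq> x" by blast
    \<comment> \<open>The orbit of \<open>x\<close>; the first \<open>p\<close> iterates suffice
      because the \<open>p\<close>-th returns to \<open>x\<close>.\<close>
    define O' where "O' = (\<lambda>i. (\<sigma> ^^ i) x) ` {..<p}"
    have p1: "p > 1" using assms(2) by (rule prime_gt_1_nat)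
    have iter: "(\<sigma> ^^ i) x \<in> X \<and> f ((\<sigma> ^^ i) x) = f x" for i
      using x(1) psubset.prems by (induction i) auto
    have funpow_funpow: "(\<sigma> ^^ a) ((\<sigma> ^^ b) y) = (\<sigma> ^^ (a + b)) y" for a b y
      by (simp add: funpow_add)
    have "i = j" if "(\<sigma> ^^ i) x = (\<sigma> ^^ j) x" "i \<le> j" "j < p" for i j
    proof (rule ccontr)
      assume "i \<noteq> j"
      with that have "\<not> p dvd j - i" by (auto dest: dvd_imp_le)
      then have "coprime (j - i) p"
        using assms(2) by (simp add: prime_imp_coprime coprime_commute)
      moreover have "(\<sigma> ^^ (j - i)) x = x"
      proof -
        \<comment> \<open>The extra \<open>p\<close> iterations leave room to split off \<sigma>^j,
          replace it by \<sigma>^i, and end with exactly \<open>p\<close> iterations.\<close>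
        have "(\<sigma> ^^ (j - i)) x = (\<sigma> ^^ (j - i)) ((\<sigma> ^^ p) x)"
          using psubset.prems(2) x by simp
        also have "\<dots> = (\<sigma> ^^ (p - i)) ((\<sigma> ^^ j) x)"
          using that(2,3) by (simp add: funpow_funpow add.commute)
        also have "\<dots> = (\<sigma> ^^ (p - i)) ((\<sigma> ^^ i) x)" by (simp add: that)
        also have "\<dots> = (\<sigma> ^^ p) x"
          using that(2,3) by (simp add: funpow_funpow)
        finally show ?thesis using psubset.prems(2) x by simp
      qed
      ultimately show False
        using funpow_coprime_fixed[of "j - i" \<sigma> x p] psubset.prems(2) x p1 by auto
    qed
    then have inj: "inj_on (\<lambda>i. (\<sigma> ^^ i) x) {..<p}"
      by (intro inj_onI) (metis lessThan_iff nat_le_linear)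
    have sub: "O' \<subseteq> X" using iter by (auto simp: O'_def)
    have "x \<in> O'" using p1 by (auto simp: O'_def intro!: image_eqI[of _ _ 0])
    have closed: "(\<sigma> ^^ m) x \<in> O'" for m
    proof -
      have "(\<sigma> ^^ (p * q)) x = x" for q
        using psubset.prems(2) x by (induction q) (simp_all add: funpow_add)
      then have "(\<sigma> ^^ m) x = (\<sigma> ^^ (m mod p)) x"
        by (metis comp_apply funpow_add mod_mult_div_eq)
      then show ?thesis using p1 by (auto simp: O'_def)
    qed
    \<comment> \<open>On \<open>X\<close> the inverse of \<sigma> is its iterate of index
      \<open>p - 1\<close>, so \<sigma> y in \<open>O'\<close> would put \<open>y\<close> itself
      into \<open>O'\<close>.\<close>
    have "\<sigma> y \<in> X - O'" if "y \<in> X - O'" for y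
    proof -
      have False if "\<sigma> y \<in> O'"
      proof -
        from that obtain i where i: "\<sigma> y = (\<sigma> ^^ i) x" by (auto simp: O'_def)
        have "y = (\<sigma> ^^ p) y" using psubset.prems(2) \<open>y \<in> X - O'\<close> by simp
        also have "\<dots> = (\<sigma> ^^ (p - 1)) (\<sigma> y)"
          using p1 by (metis Suc_diff_1 comp_apply funpow_Suc_right less_trans zero_less_one)
        also have "\<dots> = (\<sigma> ^^ (p - 1 + i)) x" by (simp add: i funpow_add)
        finally show False using closed \<open>y \<in> X - O'\<close> by (metis DiffD2)
      qed
      then show ?thesis using that psubset.prems by blast
    qed
    then have IH: "[sum f (X - O') = (\<Sum>y | y \<in> X - O' \<and> \<sigma> y = y. f y)] (mod int p)"
      using psubset.prems sub \<open>x \<in> O'\<close> x by (intro psubset.IH) auto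
    \<comment> \<open>A fixed point in the orbit would equal \<open>x\<close>, which is not fixed;
      hence removing \<open>O'\<close> loses no fixed points.\<close>
    have "\<sigma> y \<noteq> y" if "y \<in> O'" for y
    proof
      assume y: "\<sigma> y = y"
      from that obtain i where i: "y = (\<sigma> ^^ i) x" "i < p" by (auto simp: O'_def)
      have "(\<sigma> ^^ m) y = y" for m using y by (induction m) auto
      moreover have "(\<sigma> ^^ (p - i)) y = x"
        using i psubset.prems(2)[OF x(1)] by (simp add: funpow_funpow)
      ultimately show False using x y by metis
    qed
    then have "{y. y \<in> X - O' \<and> \<sigma> y = y} = {y \<in> X. \<sigma> y = y}" by auto
    moreover have "sum f X = sum f (X - O') + sum f O'"
      using sub psubset.hyps by (simp add: sum.subset_diff)
    moreover have "sum f O' = int p * f x"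
      using iter by (simp add: O'_def sum.reindex[OF inj])
    ultimately show ?thesis
      using IH by (simp add: cong_def)
  qed
qed

lemma fermat_int:
  assumes "prime p"
  shows "[a ^ p = a] (mod int p)"
proof -
  \<comment> \<open>Passing to the nonnegative residue reduces the claim to Fermat's theorem for
    natural numbers.\<close>
  define b where "b = nat (a mod int p)"
  have p: "p > 0" using assms by (rule prime_gt_0_nat)
  have b: "[int b = a] (mod int p)" using p by (simp add: b_def cong_def)
  have "[b ^ p = b] (mod p)"
  proof (cases "p dvd b")
    case True
    then have "p dvd b ^ p" using p by (intro dvd_trans[OF True dvd_power]) simp
    then show ?thesis using True by (simp add: cong_def)
  next
    case False
    from cong_mult[OF fermat_theorem[OF assms False] cong_refl[of b]]
    show ?thesis using p by (simp flip: power_Suc2)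
  qed
  then have "[int b ^ p = int b] (mod int p)"
    by (metis cong_int_iff of_nat_power)
  then show ?thesis
    using b by (metis cong_pow cong_sym cong_trans)
qed

text \<open>Being congruent to \<open>k\<close> modulo \<open>N\<close> keeps the primes dividing
  \<open>N\<close> out of \<open>K\<close>; being 1 modulo the product of all other primes up to
  \<open>B\<close> keeps those out as well.\<close>

lemma cong_avoiding_small_primes:
  fixes k N B :: nat
  assumes "coprime k N" "N > 0"
  obtains K where "[K = k] (mod N)" "K > 0" "\<And>q. prime q \<Longrightarrow> q dvd K \<Longrightarrow> B < q \<and> \<not> q dvd N"
proof -
  define P where "P = \<Prod>{q. prime q \<and> q \<le> B \<and> \<not> q dvd N}"
  have "coprime N P"
    unfolding P_def by (rule prod_coprime_right) (metis coprime_commute mem_Collect_eq prime_imp_coprime)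
  then obtain K0 where K0: "[K0 = k] (mod N)" "[K0 = 1] (mod P)"
    using binary_chinese_remainder_nat by blast
  \<comment> \<open>The solution \<open>K0\<close> may be 0; adding the combined modulus makes it
    positive.\<close>
  define K where "K = K0 + N * P"
  have fin: "finite {q. prime q \<and> q \<le> B \<and> \<not> q dvd N}"
    by (rule finite_subset[of _ "{..B}"]) auto
  have Ppos: "P > 0"
    unfolding P_def using fin by (auto intro!: prod_pos simp: prime_gt_0_nat)
  have K: "[K = k] (mod N)" "[K = 1] (mod P)"
    using K0 by (simp_all add: K_def cong_def)
  show thesis
  proof (rule that[OF K(1)])
    show "K > 0" using Ppos assms(2) by (simp add: K_def)
    fix q assume q: "prime q" "q dvd K"
    have "\<not> q dvd N"
    proof
      assume "q dvd N"
      moreover have "q dvd k"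
        using cong_dvd_iff[OF cong_dvd_modulus_nat[OF K(1) \<open>q dvd N\<close>]] q by simp
      ultimately show False
        using assms(1) q(1) by (metis coprime_common_divisor not_prime_unit)
    qed
    moreover have "B < q"
    proof (rule ccontr)
      assume "\<not> B < q"
      then have "q dvd P"
        unfolding P_def using fin \<open>\<not> q dvd N\<close> q by (intro dvd_prodI) auto
      from cong_dvd_iff[OF cong_dvd_modulus_nat[OF K(2) this]] q show False by simp
    qed
    ultimately show "B < q \<and> \<not> q dvd N" by simp
  qed
qed

subsection \<open>Conjugacy classes and powers\<close>

context group
begin

lemma conjugate_pow:
  assumes "g \<in> carrier G" "x \<in> carrier G"
  shows "(g \<otimes> x \<otimes> inv g) [^] (m::nat) = g \<otimes> x [^] m \<otimes> inv g"
proof (induction m)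
  case 0
  then show ?case using assms by simp
next
  case (Suc m)
  have "inv g \<otimes> (g \<otimes> z) = z" if "z \<in> carrier G" for z
    using assms that by (simp flip: m_assoc)
  then show ?case using Suc assms by (simp add: m_assoc)
qed

lemma conj_class_subset: "x \<in> carrier G \<Longrightarrow> conj_class G x \<subseteq> carrier G"
  by (auto simp: conj_class_eq)

lemma conj_classI:
  "g \<in> carrier G \<Longrightarrow> x \<in> carrier G \<Longrightarrow> g \<otimes> x \<otimes> inv g \<in> conj_class G x"
  by (auto simp: conj_class_eq)

lemma conj_class_refl: "x \<in> carrier G \<Longrightarrow> x \<in> conj_class G x"
  using conj_classI[of \<one> x] by simp

lemma conj_class_conjugate:
  assumes "g \<in> carrier G" "x \<in> carrier G"
  shows "conj_class G (g \<otimes> x \<otimes> inv g) = conj_class G x"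
proof -
  have conj_closed: "g \<otimes> x \<otimes> inv g \<in> carrier G" using assms by simp
  have "h \<otimes> (g \<otimes> x \<otimes> inv g) \<otimes> inv h = (h \<otimes> g) \<otimes> x \<otimes> inv (h \<otimes> g)" if "h \<in> carrier G" for h
    using that assms by (simp add: m_assoc inv_mult_group)
  moreover have "h \<otimes> x \<otimes> inv h = (h \<otimes> inv g) \<otimes> (g \<otimes> x \<otimes> inv g) \<otimes> inv (h \<otimes> inv g)"
    if "h \<in> carrier G" for h
  proof -
    have "inv g \<otimes> (g \<otimes> z) = z" if "z \<in> carrier G" for z
      using assms that by (simp flip: m_assoc)
    then show ?thesis using that assms by (simp add: m_assoc inv_mult_group)
  qed
  ultimately show ?thesis
    unfolding conj_class_eq[OF assms(2)] conj_class_eq[OF conj_closed]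
    using assms(1) by (intro equalityI subsetI; clarify) (metis m_closed inv_closed)+
qed

lemma conj_class_cong:
  "x \<in> carrier G \<Longrightarrow> y \<in> conj_class G x \<Longrightarrow> conj_class G y = conj_class G x"
  by (auto simp: conj_class_eq[of x] conj_class_conjugate)

text \<open>The modulus is any \<open>e\<close> with \<open>x [^] e = \<one>\<close>, because the
  lemma serves both for \<open>G\<close> with its exponent and for the unit group with the order of
  \<open>u\<close>.\<close>

lemma pow_cong_exponent:
  assumes "x \<in> carrier G" "x [^] e = \<one>" "[a = b] (mod e)"
  shows "x [^] (a::nat) = x [^] (b::nat)"
proof -
  have red: "x [^] a = x [^] (a mod e)" for a
  proof -
    have "x [^] (e * (a div e) + a mod e) = (x [^] e) [^] (a div e) \<otimes> x [^] (a mod e)"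
      using assms(1) by (simp only: nat_pow_mult nat_pow_pow)
    then show ?thesis using assms(1,2) by simp
  qed
  show ?thesis using red[of a] red[of b] assms(3) by (simp add: cong_def)
qed

text \<open>Powering by an inverse \<open>j\<close> of \<open>k\<close> modulo \<open>e\<close>
  undoes powering by \<open>k\<close>, and both maps commute with conjugation.\<close>

lemma pow_in_conj_class_iff:
  assumes e: "\<And>z. z \<in> carrier G \<Longrightarrow> z [^] e = \<one>" and "coprime k (e :: nat)"
    and "x \<in> carrier G" "y \<in> carrier G"
  shows "y [^] k \<in> conj_class G (x [^] k) \<longleftrightarrow> y \<in> conj_class G x"
proof
  obtain j where j: "[k * j = 1] (mod e)"
    using cong_solve_coprime_nat[OF assms(2)] by auto
  have root: "(z [^] k) [^] j = z" if "z \<in> carrier G" for z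
    using pow_cong_exponent[OF that e[OF that] j] that by (simp add: nat_pow_pow)
  assume "y [^] k \<in> conj_class G (x [^] k)"
  then obtain g where g: "g \<in> carrier G" "y [^] k = (g \<otimes> x \<otimes> inv g) [^] k"
    using assms by (auto simp: conj_class_eq conjugate_pow)
  then have "g \<otimes> x \<otimes> inv g \<in> carrier G" using assms by simp
  then have "y = g \<otimes> x \<otimes> inv g"
    using root[OF assms(4)] root g(2) by metis
  then show "y \<in> conj_class G x" using g assms by (simp add: conj_classI)
next
  assume "y \<in> conj_class G x"
  then show "y [^] k \<in> conj_class G (x [^] k)"
    using assms by (auto simp: conj_class_eq conjugate_pow)
qed

lemma group_exponent_pow:
  assumes "finite (carrier G)"
  shows "group_exponent G > 0" "z \<in> carrier G \<Longrightarrow> z [^] group_exponent G = \<one>"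
proof -
  have "order G > 0" using assms order_gt_0_iff_finite by blast
  then have "group_exponent G > 0 \<and> (\<forall>z\<in>carrier G. z [^] group_exponent G = \<one>)"
    unfolding group_exponent_def
    by (rule_tac LeastI[of _ "order G"]) (simp add: pow_order_eq_1)
  then show "group_exponent G > 0" "z \<in> carrier G \<Longrightarrow> z [^] group_exponent G = \<one>" by auto
qed

end

subsection \<open>Powers in the group ring as sums over words\<close>

primrec word_prod :: "('a, 'b) monoid_scheme \<Rightarrow> 'a list \<Rightarrow> 'a" where
  "word_prod G [] = \<one>\<^bsub>G\<^esub>"
| "word_prod G (x # xs) = x \<otimes>\<^bsub>G\<^esub> word_prod G xs"

context group
begin

lemma word_prod_closed: "set xs \<subseteq> carrier G \<Longrightarrow> word_prod G xs \<in> carrier G"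
  by (induction xs) auto

lemma word_prod_append:
  "set xs \<subseteq> carrier G \<Longrightarrow> set ys \<subseteq> carrier G \<Longrightarrow> word_prod G (xs @ ys) = word_prod G xs \<otimes> word_prod G ys"
  by (induction xs) (auto simp: word_prod_closed m_assoc)

lemma word_prod_replicate: "x \<in> carrier G \<Longrightarrow> word_prod G (replicate m x) = x [^] m"
proof (induction m)
  case (Suc m)
  then show ?case using nat_pow_Suc2[of x m] by simp
qed simp

text \<open>Moving the first letter \<open>x\<close> to the end conjugates the product by
  \<open>inv x\<close>.\<close>

lemma word_prod_rotate1_conj:
  assumes "set xs \<subseteq> carrier G" "s \<in> carrier G" "word_prod G xs \<in> conj_class G s"
  shows "word_prod G (rotate1 xs) \<in> conj_class G s"
proof (cases xs)
  case Nil
  then show ?thesis using assms by simp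
next
  case (Cons x ys)
  have cl: "x \<in> carrier G" "set ys \<subseteq> carrier G" using assms Cons by auto
  have c: "word_prod G ys \<in> carrier G" using cl(2) by (rule word_prod_closed)
  have "word_prod G (rotate1 xs) = inv x \<otimes> word_prod G xs \<otimes> inv (inv x)"
    using cl c Cons word_prod_append[of ys "[x]"] by (simp flip: m_assoc)
  also have "\<dots> \<in> conj_class G (word_prod G xs)"
    using cl c Cons by (intro conj_classI) auto
  finally show ?thesis using conj_class_cong[OF assms(2,3)] by simp
qed

text \<open>Noncommutative multinomial expansion: words with product \<open>g\<close> and first
  letter \<open>y\<close> correspond to words, one letter shorter, with product
  \<open>inv y \<otimes> g\<close>.\<close>

lemma int_group_ring_pow:
  assumes "finite (carrier G)" "w \<in> carrier (int_group_ring G)" "g \<in> carrier G"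
  shows "(w [^]\<^bsub>int_group_ring G\<^esub> m) g =
    (\<Sum>xs | set xs \<subseteq> carrier G \<and> length xs = m \<and> word_prod G xs = g. prod_list (map w xs))"
  using assms(3)
proof (induction m arbitrary: g)
  case 0
  interpret R: ring "int_group_ring G" using assms(1) by (rule int_group_ring_is_ring)
  have "{xs. set xs \<subseteq> carrier G \<and> length xs = 0 \<and> word_prod G xs = g} = (if g = \<one> then {[]} else {})"
    by auto
  then show ?case by (simp add: int_group_ring_def)
next
  case (Suc m)
  interpret R: ring "int_group_ring G" using assms(1) by (rule int_group_ring_is_ring)
  let ?S = "\<lambda>m g. {xs. set xs \<subseteq> carrier G \<and> length xs = m \<and> word_prod G xs = g}"
  have fin: "finite (?S m g)" for m g
    by (rule finite_subset[OF _ finite_lists_length_eq[OF assms(1), of m]]) auto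
  have "(w [^]\<^bsub>int_group_ring G\<^esub> Suc m) g =
      (\<Sum>y\<in>carrier G. w y * (w [^]\<^bsub>int_group_ring G\<^esub> m) (inv y \<otimes> g))"
    using Suc.prems assms(2) by (simp only: R.nat_pow_Suc2 int_group_ring_mult)
  also have "\<dots> = (\<Sum>y\<in>carrier G. \<Sum>xs\<in>?S m (inv y \<otimes> g). w y * prod_list (map w xs))"
    using Suc by (intro sum.cong refl) (simp add: sum_distrib_left)
  also have "\<dots> = (\<Sum>(y, xs)\<in>Sigma (carrier G) (\<lambda>y. ?S m (inv y \<otimes> g)). w y * prod_list (map w xs))"
    using assms(1) fin by (intro sum.Sigma) auto
  also have "\<dots> = (\<Sum>xs\<in>?S (Suc m) g. prod_list (map w xs))"
  proof (rule sum.reindex_bij_witness[where i = "\<lambda>xs. (hd xs, tl xs)" and j = "\<lambda>(y, xs). y # xs"], goal_cases)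
    case (2 a)
    then obtain y xs where "a = (y, xs)" "y \<in> carrier G" "set xs \<subseteq> carrier G" "length xs = m"
      "word_prod G xs = inv y \<otimes> g" by auto
    then show ?case using Suc.prems by (simp flip: m_assoc)
  next
    case (3 xs)
    then show ?case by (cases xs) auto
  next
    case (4 xs)
    then obtain y ys where xs: "xs = y # ys" "y \<in> carrier G" "set ys \<subseteq> carrier G" "length ys = m"
      "y \<otimes> word_prod G ys = g" by (cases xs) auto
    then have "inv y \<otimes> g = word_prod G ys"
      using word_prod_closed[of ys] by (simp flip: m_assoc add: xs(5)[symmetric])
    then show ?case using xs by simp
  qed auto
  finally show ?case .
qed

text \<open>Rotation acts on the words of length \<open>p\<close> with product in the class of
  \<open>s\<close> and preserves their weights. Modulo \<open>p\<close> only the constant words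
  survive, and Fermat turns their weights \<open>w g ^ p\<close> into \<open>w g\<close>.\<close>

lemma class_partial_augmentation_prime_pow_cong:
  assumes fin: "finite (carrier G)" and w: "w \<in> carrier (int_group_ring G)"
    and p: "prime p" and s: "s \<in> carrier G"
  shows "[partial_augmentation G s (w [^]\<^bsub>int_group_ring G\<^esub> p) =
    (\<Sum>g | g \<in> carrier G \<and> g [^] p \<in> conj_class G s. w g)] (mod int p)"
proof -
  define X where "X = {xs. set xs \<subseteq> carrier G \<and> length xs = p \<and> word_prod G xs \<in> conj_class G s}"
  have p1: "p > 1" using p by (rule prime_gt_1_nat)
  have finX: "finite X"
    unfolding X_def by (rule finite_subset[OF _ finite_lists_length_eq[OF fin, of p]]) auto
  have finC: "finite (conj_class G s)"
    using conj_class_subset[OF s] fin by (rule finite_subset)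
  have const_word: "\<exists>a\<in>carrier G. xs = replicate p a" if xs: "xs \<in> X \<and> rotate1 xs = xs" for xs
  proof -
    have "xs \<noteq> []" using xs p1 by (auto simp: X_def)
    then obtain a where "set xs = {a}"
      using rotate1_fixpoint_card xs card_1_singletonE by metis
    then show ?thesis using xs by (auto simp: X_def intro!: bexI[of _ a] replicate_eqI)
  qed
  have "partial_augmentation G s (w [^]\<^bsub>int_group_ring G\<^esub> p) =
      (\<Sum>g\<in>conj_class G s. \<Sum>xs | set xs \<subseteq> carrier G \<and> length xs = p \<and> word_prod G xs = g. prod_list (map w xs))"
    unfolding partial_augmentation_def class_partial_augmentation_def
    using fin w conj_class_subset[OF s] by (intro sum.cong int_group_ring_pow) auto
  also have "\<dots> = (\<Sum>g\<in>conj_class G s. \<Sum>xs | xs \<in> X \<and> word_prod G xs = g. prod_list (map w xs))"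
    by (rule sum.cong[OF refl], rule sum.cong) (auto simp: X_def)
  \<comment> \<open>The words in \<open>X\<close> are grouped by their product, which lies in the
    class of \<open>s\<close>.\<close>
  also have "\<dots> = (\<Sum>xs\<in>X. prod_list (map w xs))"
    using finX finC by (intro sum.group) (auto simp: X_def)
  also have "[\<dots> = (\<Sum>xs | xs \<in> X \<and> rotate1 xs = xs. prod_list (map w xs))] (mod int p)"
  proof (rule sum_fixed_points_cong[OF finX p])
    fix xs assume xs: "xs \<in> X"
    then show "rotate1 xs \<in> X"
      using word_prod_rotate1_conj[of xs s] s by (auto simp: X_def)
    show "(rotate1 ^^ p) xs = xs"
      using xs rotate_id[of p xs] by (simp add: X_def rotate_def)
    show "prod_list (map w (rotate1 xs)) = prod_list (map w xs)"
      by (cases xs) auto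
  qed
  also have "(\<Sum>xs | xs \<in> X \<and> rotate1 xs = xs. prod_list (map w xs)) =
      (\<Sum>g | g \<in> carrier G \<and> g [^] p \<in> conj_class G s. w g ^ p)"
  proof (rule sum.reindex_bij_witness[where i = "replicate p" and j = hd], goal_cases)
    case (1 xs)
    then show ?case using const_word p1 by force
  next
    case (2 xs)
    then obtain a where "a \<in> carrier G" "xs = replicate p a" using const_word by blast
    then show ?case using 2 p1 by (auto simp: X_def word_prod_replicate)
  next
    case (3 g)
    then show ?case using p1 by simp
  next
    case (4 g)
    then show ?case using p1 by (auto simp: X_def word_prod_replicate rotate1_replicate)
  next
    case (5 xs)
    then obtain a where "xs = replicate p a" using const_word by blast
    then show ?case using p1 by (simp add: prod_list_replicate)
  qed
  also have "[\<dots> = (\<Sum>g | g \<in> carrier G \<and> g [^] p \<in> conj_class G s. w g)] (mod int p)"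
    by (intro cong_sum fermat_int p)
  finally show ?thesis .
qed


section \<open>Partial augmentations of powers of a torsion unit\<close>

text \<open>Powering by \<open>q\<close> is injective on conjugacy classes, so the preceding
  congruence compares just two partial augmentations. They differ by at most
  \<open>2 * B < q\<close>, hence agree.\<close>

lemma partial_augmentation_large_prime_pow:
  fixes B :: int
  assumes fin: "finite (carrier G)" and w: "w \<in> carrier (int_group_ring G)"
    and e: "\<And>z. z \<in> carrier G \<Longrightarrow> z [^] e = \<one>"
    and q: "prime q" "\<not> q dvd e" "2 * B < int q" and x: "x \<in> carrier G"
    and B: "\<bar>partial_augmentation G x w\<bar> \<le> B"
      "\<bar>partial_augmentation G (x [^] q) (w [^]\<^bsub>int_group_ring G\<^esub> q)\<bar> \<le> B"
  shows "partial_augmentation G (x [^] q) (w [^]\<^bsub>int_group_ring G\<^esub> q) = partial_augmentation G x w"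
    (is "?a = ?b")
proof -
  have "coprime q e" using q by (simp add: prime_imp_coprime)
  then have "{g. g \<in> carrier G \<and> g [^] q \<in> conj_class G (x [^] q)} = conj_class G x"
    using pow_in_conj_class_iff[OF e] conj_class_subset[OF x] x by auto
  moreover have "x [^] q \<in> carrier G" using x by simp
  ultimately have "[?a = ?b] (mod int q)"
    using class_partial_augmentation_prime_pow_cong[OF fin w q(1), of "x [^] q"]
    by (simp add: partial_augmentation_def class_partial_augmentation_def)
  then have "int q dvd ?a - ?b" by (simp add: cong_iff_dvd_diff)
  moreover have "\<bar>?a - ?b\<bar> < int q" using B q(3) by linarith
  ultimately show ?thesis using dvd_imp_le_int[of "?a - ?b" "int q"] by auto
qed

text \<open>Prime factors of \<open>K\<close> are split off one at a time. The bound
  \<open>B\<close> is uniform over all powers of \<open>u\<close>, so it also covers the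
  intermediate powers met on the way.\<close>

lemma partial_augmentation_pow_large_prime_factors:
  fixes B :: int
  assumes fin: "finite (carrier G)" and u: "u \<in> carrier (int_group_ring G)"
    and e: "\<And>z. z \<in> carrier G \<Longrightarrow> z [^] e = \<one>"
    and B: "\<And>z m. z \<in> carrier G \<Longrightarrow> \<bar>partial_augmentation G z (u [^]\<^bsub>int_group_ring G\<^esub> (m::nat))\<bar> \<le> B"
    and x: "x \<in> carrier G"
    and "K > 0" "\<And>q. prime q \<Longrightarrow> q dvd K \<Longrightarrow> 2 * B < int q \<and> \<not> q dvd e"
  shows "partial_augmentation G (x [^] K) (u [^]\<^bsub>int_group_ring G\<^esub> K) = partial_augmentation G x u"
  using assms(6,7)
proof (induction K rule: less_induct)
  case (less K)
  interpret R: ring "int_group_ring G" using fin by (rule int_group_ring_is_ring)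
  show ?case
  proof (cases "K = 1")
    case True
    then show ?thesis using x u by simp
  next
    case False
    then obtain q where q: "prime q" "q dvd K" using prime_factor_nat by blast
    then obtain L where L: "K = L * q" by (metis dvd_div_mult_self)
    have "L > 0" "L < K" using less.prems(1) prime_gt_1_nat[OF q(1)] L by auto
    let ?w = "u [^]\<^bsub>int_group_ring G\<^esub> L"
    have pows: "x [^] K = (x [^] L) [^] q" "u [^]\<^bsub>int_group_ring G\<^esub> K = ?w [^]\<^bsub>int_group_ring G\<^esub> q"
      using x u by (simp_all add: L nat_pow_pow R.nat_pow_pow)
    have bounds: "\<bar>partial_augmentation G (x [^] L) ?w\<bar> \<le> B"
        "\<bar>partial_augmentation G ((x [^] L) [^] q) (?w [^]\<^bsub>int_group_ring G\<^esub> q)\<bar> \<le> B"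
      using B[of "x [^] L" L] B[of "x [^] K" K] x by (simp_all flip: pows)
    have "partial_augmentation G (x [^] K) (u [^]\<^bsub>int_group_ring G\<^esub> K) = partial_augmentation G (x [^] L) ?w"
      unfolding pows using less.prems(2)[OF q] q x u
      by (intro partial_augmentation_large_prime_pow[OF fin _ e _ _ _ _ bounds]) auto
    also have "\<dots> = partial_augmentation G x u"
      using less.IH[OF \<open>L < K\<close> \<open>L > 0\<close>] less.prems(2) L by simp
    finally show ?thesis .
  qed
qed

lemma partial_augmentation_pow_eq:
  assumes fin: "finite (carrier G)" and tors: "torsion_unit G u"
    and k: "coprime k (group_exponent G)" "[k = 1] (mod unit_order G u)"
    and x: "x \<in> carrier G"
  shows "partial_augmentation G (x [^] k) u = partial_augmentation G x u"
proof -
  interpret R: ring "int_group_ring G" using fin by (rule int_group_ring_is_ring)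
  interpret U: group "units_of (int_group_ring G)" by (rule R.units_group)
  let ?d = "unit_order G u" and ?e = "group_exponent G"
  have unit: "u \<in> Units (int_group_ring G)" using tors by (simp add: torsion_unit_def)
  then have u: "u \<in> carrier (int_group_ring G)" "u \<in> carrier (units_of (int_group_ring G))"
    by (auto simp: units_of_carrier)
  obtain m :: nat where m: "m > 0" "u [^]\<^bsub>int_group_ring G\<^esub> m = \<one>\<^bsub>int_group_ring G\<^esub>"
    using tors by (auto simp: torsion_unit_def)
  \<comment> \<open>The order function takes the value 0 on elements of infinite order; torsion
    rules this out.\<close>
  then have "?d dvd m"
    using U.pow_eq_id[OF u(2), of m] unit by (simp add: unit_order_def R.units_of_pow units_of_one)
  then have d: "?d > 0" using m(1) by (auto intro: Nat.gr0I)
  have pow_cong: "u [^]\<^bsub>int_group_ring G\<^esub> a = u [^]\<^bsub>int_group_ring G\<^esub> b" if "[a = b] (mod ?d)" for a b :: nat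
    using U.pow_cong_exponent[OF u(2) _ that] U.pow_ord_eq_1[OF u(2)] unit
    by (simp add: unit_order_def R.units_of_pow)
  \<comment> \<open>A crude uniform bound: powers of \<open>u\<close> depend only on the exponent
    modulo \<open>?d\<close>, so finitely many absolute values are summed.\<close>
  define B where "B = (\<Sum>(z, i)\<in>carrier G \<times> {..<?d}. \<bar>partial_augmentation G z (u [^]\<^bsub>int_group_ring G\<^esub> i)\<bar>)"
  have B: "\<bar>partial_augmentation G z (u [^]\<^bsub>int_group_ring G\<^esub> i)\<bar> \<le> B" if "z \<in> carrier G" for z and i :: nat
  proof -
    have "u [^]\<^bsub>int_group_ring G\<^esub> i = u [^]\<^bsub>int_group_ring G\<^esub> (i mod ?d)"
      by (rule pow_cong) (simp add: cong_def)
    moreover have "\<bar>partial_augmentation G z (u [^]\<^bsub>int_group_ring G\<^esub> (i mod ?d))\<bar> \<le> B"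
      unfolding B_def using that fin d
      by (intro member_le_sum[of "(z, i mod ?d)" _ "\<lambda>(z, i). \<bar>partial_augmentation G z (u [^]\<^bsub>int_group_ring G\<^esub> i)\<bar>", simplified]) auto
    ultimately show ?thesis by simp
  qed
  \<comment> \<open>Working modulo \<open>?e * ?d\<close> lets one \<open>K\<close> satisfy both
    \<open>x [^] K = x [^] k\<close> and \<open>u ^ K = u\<close>.\<close>
  have "coprime k ?d"
    using cong_imp_coprime[OF cong_sym[OF k(2)]] by simp
  then have cop: "coprime k (?e * ?d)" using k(1) by simp
  have N: "?e * ?d > 0" using d group_exponent_pow[OF fin] by simp
  obtain K where K: "[K = k] (mod ?e * ?d)" "K > 0"
      "\<And>q. prime q \<Longrightarrow> q dvd K \<Longrightarrow> nat (2 * B) < q \<and> \<not> q dvd ?e * ?d"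
    using cong_avoiding_small_primes[OF cop N] by metis
  have "x [^] K = x [^] k"
    using x group_exponent_pow[OF fin] K(1)
    by (intro pow_cong_exponent[of x ?e]) (auto intro: cong_dvd_modulus_nat)
  moreover have "[K = 1] (mod ?d)"
    using K(1) k(2) by (metis cong_dvd_modulus_nat cong_trans dvd_triv_right)
  then have "u [^]\<^bsub>int_group_ring G\<^esub> K = u"
    using pow_cong[of K 1] u(1) by simp
  moreover have "2 * B < int q \<and> \<not> q dvd ?e" if "prime q" "q dvd K" for q
    using K(3)[OF that] by auto
  then have "partial_augmentation G (x [^] K) (u [^]\<^bsub>int_group_ring G\<^esub> K) = partial_augmentation G x u"
    using fin u(1) group_exponent_pow(2)[OF fin] B x K(2)
    by (intro partial_augmentation_pow_large_prime_factors[of u ?e B]) auto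
  ultimately show ?thesis by simp
qed

section \<open>Collapse of the double sum\<close>

text \<open>Only the class of \<open>x\<close> has its \<open>k\<close>-th powers in the class of
  \<open>x [^] k\<close>. Conjugating a root \<open>y\<close> along with \<open>x\<close> shows that
  solvability does not depend on the representative.\<close>

lemma root_classes_eq:
  assumes fin: "finite (carrier G)" and k: "coprime k (group_exponent G)"
    and x: "x \<in> carrier G" and "r dvd t" "t dvd n"
  shows "root_classes G k n r t (x [^] k) =
    (if \<exists>y\<in>carrier G. y [^] (k * (n * r div t)) = x [^] k then {conj_class G x} else {})"
proof -
  have exp: "k * n * r div t = k * (n * r div t)"
    using assms(5) by (metis div_mult_swap dvd_mult2 mult.assoc)
  have root_transfer: "\<exists>y\<in>carrier G. y [^] (m::nat) = b [^] k"
    if ab: "a \<in> carrier G" "b \<in> conj_class G a" "\<exists>y\<in>carrier G. y [^] m = a [^] k" for a b m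
  proof -
    obtain y where "y \<in> carrier G" "y [^] m = a [^] k" using ab(3) by blast
    moreover obtain g where "g \<in> carrier G" "b = g \<otimes> a \<otimes> inv g"
      using ab(2) by (auto simp: conj_class_eq[OF ab(1)])
    ultimately have "g \<otimes> y \<otimes> inv g \<in> carrier G" "(g \<otimes> y \<otimes> inv g) [^] m = b [^] k"
      using ab(1) by (simp_all add: conjugate_pow)
    then show ?thesis by blast
  qed
  have cls: "z [^] k \<in> conj_class G (x [^] k) \<longleftrightarrow> z \<in> conj_class G x" if "z \<in> carrier G" for z
    using pow_in_conj_class_iff[OF group_exponent_pow(2)[OF fin] k x that] .
  have "root_classes G k n r t (x [^] k) = {conj_class G z | z. z \<in> conj_class G x \<and>
      (\<exists>y\<in>carrier G. y [^] (k * (n * r div t)) = z [^] k)}"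
    unfolding root_classes_def exp using cls conj_class_subset[OF x] by blast
  also have "\<dots> = {conj_class G x | z. z \<in> conj_class G x \<and>
      (\<exists>y\<in>carrier G. y [^] (k * (n * r div t)) = x [^] k)}"
  proof -
    have "(\<exists>y\<in>carrier G. y [^] (k * (n * r div t)) = z [^] k) \<longleftrightarrow>
        (\<exists>y\<in>carrier G. y [^] (k * (n * r div t)) = x [^] k)" if z: "z \<in> conj_class G x" for z
    proof -
      have "z \<in> carrier G" "x \<in> conj_class G z"
        using z conj_class_subset[OF x] conj_class_cong[OF x z] conj_class_refl[OF x] by auto
      then show ?thesis using root_transfer[of x z] root_transfer[of z x] x z by blast
    qed
    then show ?thesis using conj_class_cong[OF x] by (intro Collect_cong) metis
  qed
  also have "\<dots> = (if \<exists>y\<in>carrier G. y [^] (k * (n * r div t)) = x [^] k then {conj_class G x} else {})"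
    using conj_class_refl[OF x] by auto
  finally show ?thesis .
qed

end

theorem theorem1:
  fixes G :: "('a, 'b) monoid_scheme"
    and u :: "'a \<Rightarrow> int"
    and k n :: nat
    and s :: 'a
  assumes "group G"
    and "finite (carrier G)"
    and "u \<in> normalized_units G"
    and "torsion_unit G u"
    and "k > 0" and "n > 0"
    and "coprime k (group_exponent G)"
    and "[n = 1] (mod unit_order G u)"
    and "[k = 1] (mod unit_order G u)"
    and "s \<in> carrier G"
  shows "partial_augmentation G s u =
    (\<Sum>(r, t) | 0 < r \<and> 0 < t \<and> r dvd t \<and> t dvd n.
       moebius r * (\<Sum>C\<in>root_classes G k n r t s. class_partial_augmentation C u))"
proof -
  interpret group G by fact
  obtain j where "[k * j = 1] (mod group_exponent G)"
    using cong_solve_coprime_nat[OF assms(7)] by auto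
  \<comment> \<open>Powering by \<open>j\<close> inverts powering by \<open>k\<close>, so
    \<open>x\<close> is a \<open>k\<close>-th root of \<open>s\<close>.\<close>
  define x where "x = s [^]\<^bsub>G\<^esub> j"
  have x: "x \<in> carrier G" using assms(10) by (simp add: x_def)
  have xk: "x [^]\<^bsub>G\<^esub> k = s"
    using pow_cong_exponent[OF assms(10) group_exponent_pow(2)[OF assms(2,10)]
        \<open>[k * j = 1] (mod group_exponent G)\<close>] assms(10)
    by (simp add: x_def nat_pow_pow mult.commute)
  \<comment> \<open>The inner sum as a function of \<open>d = n * r div t\<close>; the value 0 is
    the sum over an empty set of classes.\<close>
  define f where "f d = (if \<exists>y\<in>carrier G. y [^]\<^bsub>G\<^esub> (k * d) = s
      then partial_augmentation G x u else 0)" for d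
  have "(\<Sum>(r, t) | 0 < r \<and> 0 < t \<and> r dvd t \<and> t dvd n.
       moebius r * (\<Sum>C\<in>root_classes G k n r t s. class_partial_augmentation C u)) =
     (\<Sum>(r, t) | 0 < r \<and> 0 < t \<and> r dvd t \<and> t dvd n. moebius r * f (n * r div t))"
    using root_classes_eq[OF assms(2,7) x, unfolded xk]
    by (intro sum.cong) (auto simp: f_def partial_augmentation_def)
  also have "\<dots> = f 1"
    using assms(6) by (rule moebius_divisor_pairs_sum)
  \<comment> \<open>For \<open>d = 1\<close> the element \<open>x\<close> is itself the required
    root, and the partial augmentations of \<open>u\<close> at \<open>x\<close> and
    \<open>x [^] k = s\<close> agree.\<close>
  also have "\<dots> = partial_augmentation G s u"
    using partial_augmentation_pow_eq[OF assms(2,4,7,9) x] x xk by (auto simp: f_def)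
  finally show ?thesis by simp
qed

end
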